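(* Let $G = C_n^r$, where $r\in \mathbb N_+$ and $n\in \mathbb N_{\geq 2}$, and let $p$ be a prime divisor of $n$. If $\ell\in \mathbb N_+$ is such that $r\ge\theta(\ell;p)\ge 1$, then there exists a sequence $S$ over $G$ of length $$|S|=(n-1)r+(p-1)\ell=\mathsf D^*(G)+(p-1)\ell-1,$$ such that every nonempty zero-sum subsequence $T$ of $S$ has length $$|T|=\omega(\ell;n,p).$$
   Context: $C_n$ denotes the cyclic group of order $n$, written additively, and $\mathbb N_+$ denotes the positive integers. A sequence over a finite abelian group $G$ is a finite unordered sequence (multiset) of elements of $G$, repetition allowed; its length is the number of terms counted with multiplicity; a subsequence is a sub-multiset. A sequence is zero-sum if the sum of its terms is $0$. If $G\cong C_{n_1}\oplus\dots\oplus C_{n_s}$ with $1<n_1\mid\dots\mid n_s$, then $\mathsf D^*(G)=1+\sum_{i=1}^s(n_i-1)$. For a prime $p$, an integer $n\ge 2$ divisible by $p$, and $\ell\in\mathbb N_+$, define $$\theta(\ell;p)=\begin{cases}\frac{2(p^\ell-1)}{p-1}-\ell, & p>2,\\ 2^\ell-1-\ell, & p=2,\end{cases}\qquad \omega(\ell;n,p)=\begin{cases}p^{\ell-1}n, & p>2,\\ 2^{\ell-2}n, & p=2.\end{cases}$$ *)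

theory Defs
  imports
    "HOL-Algebra.FiniteProduct"
    "HOL-Algebra.Product_Groups"
    "HOL-Computational_Algebra.Primes"
    "HOL-Library.Multiset"
begin

text \<open>
  Abelian groups are HOL-Algebra records, so the group operation is written multiplicatively
  there; for \<^const>\<open>integer_mod_group\<close> it is addition modulo \<open>n\<close>, and \<open>\<one>\<close> is \<open>0\<close>.
  A sequence over \<open>G\<close> is a multiset whose support lies in the carrier of \<open>G\<close>.
\<close>

definition direct_sum_cyclic :: "nat list \<Rightarrow> (nat \<Rightarrow> int) monoid" where
  "direct_sum_cyclic ns = product_group {..<length ns} (\<lambda>i. integer_mod_group (ns ! i))"

definition cyclic_power :: "nat \<Rightarrow> nat \<Rightarrow> (nat \<Rightarrow> int) monoid" where
  "cyclic_power n r = product_group {..<r} (\<lambda>_. integer_mod_group n)"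

definition sequence_over :: "('a, 'b) monoid_scheme \<Rightarrow> 'a multiset \<Rightarrow> bool" where
  "sequence_over G S \<longleftrightarrow> set_mset S \<subseteq> carrier G"

text \<open>The sum of the terms of \<open>S\<close>, collected by value: \<open>\<Sum>\<^sub>g v\<^sub>g(S) g\<close>, where \<open>v\<^sub>g(S)\<close> is the
  multiplicity of \<open>g\<close> in \<open>S\<close>.\<close>

definition seq_sum :: "('a, 'b) monoid_scheme \<Rightarrow> 'a multiset \<Rightarrow> 'a" where
  "seq_sum G S = finprod G (\<lambda>g. g [^]\<^bsub>G\<^esub> count S g) (set_mset S)"

definition zero_sum :: "('a, 'b) monoid_scheme \<Rightarrow> 'a multiset \<Rightarrow> bool" where
  "zero_sum G S \<longleftrightarrow> seq_sum G S = \<one>\<^bsub>G\<^esub>"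

definition invariant_factors :: "('a, 'b) monoid_scheme \<Rightarrow> nat list \<Rightarrow> bool" where
  "invariant_factors G ns \<longleftrightarrow>
     (\<forall>m \<in> set ns. 1 < m) \<and> sorted_wrt (dvd) ns \<and> G \<cong> direct_sum_cyclic ns"

text \<open>For a finite abelian group the invariant factors exist and are unique, so the
  description below denotes a number; the trivial group has the empty list of factors.\<close>

definition D_star :: "('a, 'b) monoid_scheme \<Rightarrow> nat" where
  "D_star G = (THE d. \<exists>ns. invariant_factors G ns \<and> d = 1 + (\<Sum>m\<leftarrow>ns. m - 1))"

text \<open>The division in \<open>theta\<close> is exact, since \<open>p - 1\<close> divides \<open>p ^ l - 1\<close>.\<close>

definition theta :: "nat \<Rightarrow> nat \<Rightarrow> int" where
  "theta l p =
     (if p > 2 then (2 * (int p ^ l - 1)) div (int p - 1) - int l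
      else 2 ^ l - 1 - int l)"

text \<open>\<open>omega\<close> is rational-valued because of the exponent \<open>l - 2\<close>, which is \<open>-1\<close> for \<open>l = 1\<close>.\<close>

definition omega :: "nat \<Rightarrow> nat \<Rightarrow> nat \<Rightarrow> rat" where
  "omega l n p =
     (if p > 2 then of_nat p powi (int l - 1) * of_nat n
      else 2 powi (int l - 2) * of_nat n)"

end

theory Submission
  imports Defs
begin

text \<open>
  The construction is modelled on simplex codes. Let \<open>n = m p\<close>. The sequence consists of the basis
  vectors \<open>e\<^sub>i\<close>, each \<open>n - 1\<close> times, and of \<open>l\<close> further elements \<open>f\<^sub>j\<close>, each \<open>p - 1\<close> times. A
  zero-sum subsequence is determined by the multiplicities \<open>b \<in> {0..<p}\<^sup>l\<close> of the \<open>f\<^sub>j\<close>. For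
  \<open>p > 2\<close> the coordinates of the \<open>f\<^sub>j\<close> are \<open>e\<^sub>1, \<dots>, e\<^sub>l\<close> and, for every other point \<open>v\<close> of the projective
  space over \<open>F\<^sub>p\<close>, the two functionals \<open>m v\<close> and \<open>- m v\<close>. Opposite coordinates contribute \<open>n\<close> to
  the length if \<open>v \<cdot> b \<noteq> 0\<close> and \<open>0\<close> otherwise, and so does \<open>b\<^sub>j\<close> together with the coordinate
  \<open>e\<^sub>j\<close>. Since \<open>v \<cdot> b \<noteq> 0\<close> for exactly \<open>p\<^sup>l\<^sup>-\<^sup>1\<close> points \<open>v\<close> whenever \<open>b \<noteq> 0\<close>, every length is
  \<open>p\<^sup>l\<^sup>-\<^sup>1 n\<close>. For \<open>p = 2\<close> a single coordinate \<open>m v\<close> for every nonunit point \<open>v\<close> suffices, up to a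
  correction of one entry per \<open>f\<^sub>j\<close>.
\<close>

subsection \<open>Invariant factors of powers of a cyclic group\<close>

lemma card_carrier_direct_sum_cyclic:
  assumes "\<forall>m\<in>set ns. m > 0"
  shows "card (carrier (direct_sum_cyclic ns)) = prod_list ns"
proof -
  have "card (carrier (direct_sum_cyclic ns)) = (\<Prod>i<length ns. ns ! i)"
    using assms by (auto simp: direct_sum_cyclic_def card_PiE carrier_integer_mod_group intro!: prod.cong)
  then show ?thesis by (simp add: prod.list_conv_set_nth atLeast0LessThan)
qed

lemma direct_sum_cyclic_pow:
  "x [^]\<^bsub>direct_sum_cyclic ns\<^esub> (k::nat) =
     (\<lambda>i\<in>{..<length ns}. (int k * x i) mod int (ns ! i))"
proof (induction k)
  case (Suc k)
  then show ?case
    by (auto simp: direct_sum_cyclic_def mod_add_right_eq algebra_simps fun_eq_iff)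
qed (simp add: direct_sum_cyclic_def)

lemma group_direct_sum_cyclic: "group (direct_sum_cyclic ns)"
  unfolding direct_sum_cyclic_def by (rule product_group) simp

lemma card_torsion:
  assumes "q > 0" "m > 0" "q dvd m"
  shows "card {x \<in> {0..<int m}. int q * x mod int m = 0} = q"
proof -
  obtain k where m: "m = q * k" using assms(3) by blast
  with assms have k: "k > 0" by simp
  have "{x \<in> {0..<int m}. int q * x mod int m = 0} = (\<lambda>t. int k * t) ` {0..<int q}"
    using assms(1) k by (auto simp: m mod_eq_0_iff_dvd mult.commute elim!: dvdE
      intro!: image_eqI) (auto simp: mult.assoc mult.left_commute zero_le_mult_iff)
  then show ?thesis using k by (simp add: card_image inj_on_def)
qed

text \<open>Torsion is counted coordinatewise. Only the number of factors enters, so the count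
  recovers the rank; on the cyclic power, \<open>q = n\<close> gives the whole order
  \<open>n ^ r\<close>.\<close>

lemma card_torsion_direct_sum_cyclic:
  assumes "q > 0" "\<forall>m\<in>set ns. m > 0 \<and> q dvd m"
  shows "card {x \<in> carrier (direct_sum_cyclic ns).
      x [^]\<^bsub>direct_sum_cyclic ns\<^esub> q = \<one>\<^bsub>direct_sum_cyclic ns\<^esub>} = q ^ length ns"
proof -
  have "{x \<in> carrier (direct_sum_cyclic ns).
      x [^]\<^bsub>direct_sum_cyclic ns\<^esub> q = \<one>\<^bsub>direct_sum_cyclic ns\<^esub>}
    = (\<Pi>\<^sub>E i\<in>{..<length ns}. {x \<in> {0..<int (ns ! i)}. int q * x mod int (ns ! i) = 0})"
    (is "?L = ?R")
  proof (rule Set.set_eqI)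
    fix x
    have "x [^]\<^bsub>direct_sum_cyclic ns\<^esub> q = \<one>\<^bsub>direct_sum_cyclic ns\<^esub>
        \<longleftrightarrow> (\<forall>i<length ns. int q * x i mod int (ns ! i) = 0)"
      unfolding direct_sum_cyclic_pow by (auto simp: direct_sum_cyclic_def fun_eq_iff restrict_def)
    moreover have "x \<in> carrier (direct_sum_cyclic ns)
        \<longleftrightarrow> x \<in> (\<Pi>\<^sub>E i\<in>{..<length ns}. {0..<int (ns ! i)})"
      using assms(2) by (auto simp: direct_sum_cyclic_def PiE_iff carrier_integer_mod_group)
    ultimately show "x \<in> ?L \<longleftrightarrow> x \<in> ?R" by (auto simp: PiE_iff)
  qed
  then have "card ?L = (\<Prod>i<length ns. card {x \<in> {0..<int (ns ! i)}. int q * x mod int (ns ! i) = 0})"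
    by (simp add: card_PiE)
  also have "\<dots> = (\<Prod>i<length ns. q)"
    using assms by (intro prod.cong refl card_torsion) auto
  finally show ?thesis by simp
qed

lemma iso_torsion_card:
  assumes "group G" "group H" "G \<cong> H"
  shows "card {x \<in> carrier G. x [^]\<^bsub>G\<^esub> (q::nat) = \<one>\<^bsub>G\<^esub>}
       = card {x \<in> carrier H. x [^]\<^bsub>H\<^esub> q = \<one>\<^bsub>H\<^esub>}"
proof -
  obtain f where f: "f \<in> iso G H" using assms(3) by (auto simp: is_iso_def)
  interpret group_hom G H f
    using assms f by (auto simp: group_hom_def group_hom_axioms_def iso_def)
  have bij: "bij_betw f (carrier G) (carrier H)" using f by (simp add: iso_def)
  have "f x [^]\<^bsub>H\<^esub> q = \<one>\<^bsub>H\<^esub> \<longleftrightarrow> x [^]\<^bsub>G\<^esub> q = \<one>\<^bsub>G\<^esub>" if "x \<in> carrier G" for x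
    using that bij by (metis G.nat_pow_closed G.one_closed bij_betw_def hom_nat_pow hom_one inj_onD)
  then have "bij_betw f {x \<in> carrier G. x [^]\<^bsub>G\<^esub> q = \<one>\<^bsub>G\<^esub>} {x \<in> carrier H. x [^]\<^bsub>H\<^esub> q = \<one>\<^bsub>H\<^esub>}"
    by (intro bij_betw_Collect[OF bij])
  then show ?thesis by (rule bij_betw_same_card)
qed

text \<open>A single factor below \<open>n\<close> would push the product strictly below the power,
  since the others are at most \<open>n\<close>.\<close>

lemma prod_list_eq_power_imp_replicate:
  fixes ns :: "nat list"
  assumes "\<forall>m\<in>set ns. 0 < m \<and> m \<le> n" "prod_list ns = n ^ length ns"
  shows "ns = replicate (length ns) n"
  using assms
proof (induction ns)
  case (Cons m ns)
  have le: "prod_list ns \<le> n ^ length ns"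
    using Cons.prems(1) by (induction ns) (auto intro: mult_mono)
  have n: "n > 0" using Cons.prems(1) by auto
  have pos: "prod_list ns > 0" using Cons.prems(1) by (induction ns) auto
  have "m = n"
  proof (rule ccontr)
    assume "m \<noteq> n"
    then have "m * prod_list ns < n * prod_list ns" using Cons.prems(1) pos by simp
    also have "\<dots> \<le> n * n ^ length ns" using le by simp
    finally show False using Cons.prems(2) by simp
  qed
  with Cons n show ?case by simp
qed simp

lemma cyclic_power_eq_direct_sum: "cyclic_power n r = direct_sum_cyclic (replicate r n)"
proof -
  have "(\<Pi>\<^sub>E i\<in>{..<r}. carrier (integer_mod_group n))
      = (\<Pi>\<^sub>E i\<in>{..<r}. carrier (integer_mod_group (replicate r n ! i)))"
    by (rule PiE_cong) simp
  then show ?thesis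
    by (simp add: cyclic_power_def direct_sum_cyclic_def product_group_def fun_eq_iff restrict_def)
qed

text \<open>\<open>D_star\<close> is a definite description, so the factors must be shown unique.
  The group order, its exponent and the number of torsion elements for one prime leave only
  \<open>r\<close> factors equal to \<open>n\<close>.\<close>

lemma invariant_factors_cyclic_power:
  assumes "r \<ge> 1" "n \<ge> 2"
  shows "invariant_factors (cyclic_power n r) ns \<longleftrightarrow> ns = replicate r n"
proof
  let ?R = "replicate r n"
  assume inv: "invariant_factors (cyclic_power n r) ns"
  then have gt: "\<forall>m\<in>set ns. 1 < m" and sorted: "sorted_wrt (dvd) ns"
    and iso: "direct_sum_cyclic ?R \<cong> direct_sum_cyclic ns"
    by (auto simp: invariant_factors_def cyclic_power_eq_direct_sum)
  note tor = iso_torsion_card[OF group_direct_sum_cyclic group_direct_sum_cyclic iso]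
  have prod: "prod_list ns = n ^ r"
  proof -
    have "card (carrier (direct_sum_cyclic ?R)) = card (carrier (direct_sum_cyclic ns))"
      using iso by (auto simp: is_iso_def iso_def dest: bij_betw_same_card)
    then show ?thesis using assms gt
      by (subst (asm) (1 2) card_carrier_direct_sum_cyclic) (auto simp: prod_list_replicate)
  qed
  have dvd: "m dvd n" if m: "m \<in> set ns" for m
  proof -
    obtain i where i: "i < length ns" "m = ns ! i" using m by (auto simp: in_set_conv_nth)
    let ?H = "direct_sum_cyclic ns"
    have "card {x \<in> carrier ?H. x [^]\<^bsub>?H\<^esub> n = \<one>\<^bsub>?H\<^esub>} = card (carrier ?H)"
      using tor[of n, symmetric] assms gt prod
      by (subst card_carrier_direct_sum_cyclic) (auto simp: card_torsion_direct_sum_cyclic)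
    moreover have fin: "finite (carrier ?H)"
      using assms gt prod card_carrier_direct_sum_cyclic[of ns]
      by (metis card.infinite dual_order.strict_trans less_numeral_extra(1) not_numeral_le_zero power_eq_0_iff)
    ultimately have all: "{x \<in> carrier ?H. x [^]\<^bsub>?H\<^esub> n = \<one>\<^bsub>?H\<^esub>} = carrier ?H"
      by (intro card_subset_eq) auto
    \<comment> \<open>The all-ones element tests every factor at once: coordinate \<open>i\<close>
      of its \<open>n\<close>-fold multiple is \<open>n mod m\<close>.\<close>
    let ?x = "\<lambda>k\<in>{..<length ns}. 1 :: int"
    have "?x \<in> carrier ?H"
      using gt by (auto simp: direct_sum_cyclic_def carrier_integer_mod_group)
    then have "?x [^]\<^bsub>?H\<^esub> n = \<one>\<^bsub>?H\<^esub>" using all by blast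
    then have "(?x [^]\<^bsub>?H\<^esub> n) i = \<one>\<^bsub>?H\<^esub> i" by (rule fun_cong)
    then have "int n mod int m = 0"
      using i unfolding direct_sum_cyclic_pow by (simp add: direct_sum_cyclic_def)
    then show ?thesis by presburger
  qed
  have "n ^ r \<noteq> 1" using assms by simp
  then have ne: "ns \<noteq> []" using prod by (metis prod_list.Nil)
  \<comment> \<open>A prime divisor of the first factor divides all factors, and hence
    \<open>n\<close>; comparing \<open>q\<close>-torsion on both sides then compares the
    ranks.\<close>
  obtain q where q: "prime q" "q dvd hd ns"
    using gt ne by (metis prime_factor_nat hd_in_set nat_neq_iff)
  have qdvd: "q dvd m" if "m \<in> set ns" for m
    using that sorted q(2) ne by (cases ns) (auto intro: dvd_trans)
  have "q ^ r = q ^ length ns"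
  proof -
    have "\<forall>m\<in>set ns. m > 0 \<and> q dvd m" "\<forall>m\<in>set ?R. m > 0 \<and> q dvd m"
      using gt qdvd assms dvd_trans[OF q(2) dvd[OF hd_in_set[OF ne]]] by auto
    then show ?thesis
      using tor[of q] prime_gt_0_nat[OF q(1)] by (simp only: card_torsion_direct_sum_cyclic length_replicate)
  qed
  then have len: "length ns = r" using q(1) prime_gt_1_nat power_inject_exp by metis
  have "ns = replicate (length ns) n"
    using gt dvd assms prod len
    by (intro prod_list_eq_power_imp_replicate) (auto intro!: dvd_imp_le)
  then show "ns = ?R" using len by simp
next
  assume "ns = replicate r n"
  then show "invariant_factors (cyclic_power n r) ns"
    using assms by (auto simp: invariant_factors_def cyclic_power_eq_direct_sum sorted_wrt_iff_nth_less iso_refl)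
qed

lemma D_star_cyclic_power:
  assumes "r \<ge> 1" "n \<ge> 2"
  shows "D_star (cyclic_power n r) = 1 + r * (n - 1)"
  unfolding D_star_def invariant_factors_cyclic_power[OF assms]
  by (simp add: sum_list_replicate)

subsection \<open>Zero-sum subsequences and weights\<close>

lemma comm_group_cyclic_power: "comm_group (cyclic_power n r)"
proof (rule group.group_comm_groupI)
  show "group (cyclic_power n r)"
    unfolding cyclic_power_def by (rule product_group) simp
qed (auto simp: cyclic_power_def add.commute)

lemma cyclic_power_pow:
  assumes "i < r"
  shows "(x [^]\<^bsub>cyclic_power n r\<^esub> (k::nat)) i = (int k * x i) mod int n"
  using assms by (simp add: cyclic_power_eq_direct_sum direct_sum_cyclic_pow)

lemma sum_mset_eq_sum_count:
  fixes h :: "'a \<Rightarrow> 'b::comm_semiring_1"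
  assumes "finite A" "set_mset M \<subseteq> A"
  shows "(\<Sum>x\<in>#M. h x) = (\<Sum>x\<in>A. of_nat (count M x) * h x)"
  using assms(2)
proof (induction M)
  case (add y M)
  then have "(\<Sum>x\<in>A. of_nat (count (add_mset y M) x) * h x)
     = (\<Sum>x\<in>A. (if x = y then h x else 0) + of_nat (count M x) * h x)"
    by (intro sum.cong) (auto simp: algebra_simps)
  with add assms(1) show ?case by (simp add: sum.distrib)
qed simp

lemma seq_sum_cyclic_power:
  assumes "i < r" "sequence_over (cyclic_power n r) S"
  shows "seq_sum (cyclic_power n r) S i = (\<Sum>x\<in>#S. x i) mod int n"
proof -
  let ?G = "cyclic_power n r"
  interpret comm_group ?G by (rule comm_group_cyclic_power)
  \<comment> \<open>The multiplicities \<open>c\<close> are independent of the support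
    \<open>A\<close>, so that the induction on \<open>A\<close> leaves them fixed.\<close>
  have "finprod ?G (\<lambda>g. g [^]\<^bsub>?G\<^esub> c g) A i = (\<Sum>g\<in>A. int (c g) * g i) mod int n"
    if "finite A" "A \<subseteq> carrier ?G" for A and c :: "_ \<Rightarrow> nat"
    using that
  proof (induction A)
    case empty
    have "finprod ?G (\<lambda>g. g [^]\<^bsub>?G\<^esub> c g) {} = \<one>\<^bsub>?G\<^esub>" by (rule finprod_empty)
    then show ?case using assms(1) by (simp add: cyclic_power_def)
  next
    case (insert g A)
    have "finprod ?G (\<lambda>g. g [^]\<^bsub>?G\<^esub> c g) (insert g A)
        = g [^]\<^bsub>?G\<^esub> c g \<otimes>\<^bsub>?G\<^esub> finprod ?G (\<lambda>g. g [^]\<^bsub>?G\<^esub> c g) A"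
      using insert by (intro finprod_insert) auto
    then have "finprod ?G (\<lambda>g. g [^]\<^bsub>?G\<^esub> c g) (insert g A) i = ((g [^]\<^bsub>?G\<^esub> c g) i + finprod ?G (\<lambda>g. g [^]\<^bsub>?G\<^esub> c g) A i) mod int n"
      using assms(1) by (simp add: cyclic_power_def)
    then show ?case using insert assms(1) by (simp add: cyclic_power_pow mod_add_eq)
  qed
  then show ?thesis
    using assms(2) unfolding seq_sum_def sequence_over_def
    by (subst sum_mset_eq_sum_count[of "set_mset S"]) auto
qed

lemma zero_sum_cyclic_powerD:
  assumes "zero_sum (cyclic_power n r) S" "sequence_over (cyclic_power n r) S" "i < r"
  shows "int n dvd (\<Sum>x\<in>#S. x i)"
proof -
  have "(\<Sum>x\<in>#S. x i) mod int n = 0"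
    using assms seq_sum_cyclic_power[OF assms(3,2)] by (simp add: zero_sum_def cyclic_power_def)
  then show ?thesis by auto
qed

lemma subseteq_image_msetE:
  assumes "T \<subseteq># image_mset f M"
  obtains N where "N \<subseteq># M" "T = image_mset f N"
proof -
  have "image_mset f M = T + (image_mset f M - T)" using assms by simp
  then obtain N K where "M = N + K" "T = image_mset f N"
    using image_mset_eq_plusD by blast
  then show ?thesis by (intro that[of N]) simp_all
qed

text \<open>The sequence consists of \<open>n - 1\<close> copies of each standard basis vector and \<open>p - 1\<close> copies of
  each row of \<open>F\<close>. The multiplicities \<open>b j\<close> of the rows in a zero-sum subsequence determine those
  of the basis vectors, so its length is the left-hand side of \<open>weight\<close>.\<close>

lemma sequence_from_matrix:
  fixes F :: "nat \<Rightarrow> 'i \<Rightarrow> int"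
  assumes "n \<ge> 2" "finite I" "card I \<le> r"
    and weight: "\<And>b. (\<forall>j<l. 0 \<le> b j \<and> b j < int p) \<Longrightarrow> (\<exists>j<l. b j \<noteq> 0) \<Longrightarrow>
      (\<Sum>j<l. b j) + (\<Sum>i\<in>I. (- (\<Sum>j<l. b j * F j i)) mod int n) = W"
  shows "\<exists>S. sequence_over (cyclic_power n r) S \<and> size S = (n - 1) * r + (p - 1) * l \<and>
    (\<forall>T. T \<subseteq># S \<and> T \<noteq> {#} \<and> zero_sum (cyclic_power n r) T \<longrightarrow> int (size T) = W)"
proof -
  let ?G = "cyclic_power n r"
  obtain h where h: "bij_betw h {..<card I} I"
    using ex_bij_betw_nat_finite[OF assms(2)] by (auto simp: atLeast0LessThan)
  \<comment> \<open>Coordinates beyond \<open>card I\<close> are padded with zeros. There the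
    zero-sum condition forces multiplicity 0 of the basis vector, so a larger rank does not change
    the lengths.\<close>
  define F' where "F' = (\<lambda>j k. if k < card I then F j (h k) else 0)"
  \<comment> \<open>The tags \<open>Inl\<close> and \<open>Inr\<close> record the origin of a term,
    so rows that coincide with each other or with basis vectors keep separate
    multiplicities.\<close>
  define g :: "nat + nat \<Rightarrow> nat \<Rightarrow> int" where
    "g = case_sum (\<lambda>i. \<lambda>k\<in>{..<r}. if k = i then 1 else 0) (\<lambda>j. \<lambda>k\<in>{..<r}. F' j k mod int n)"
  define M where "M = repeat_mset (n - 1) (mset_set (Inl ` {..<r}))
    + repeat_mset (p - 1) (mset_set (Inr ` {..<l}))"
  define S where "S = image_mset g M"
  have g_carrier: "g x \<in> carrier ?G" for x
    using assms(1) by (cases x) (auto simp: g_def cyclic_power_def carrier_integer_mod_group)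
  then have over: "sequence_over ?G (image_mset g N)" for N
    by (auto simp: sequence_over_def)
  have size: "size S = (n - 1) * r + (p - 1) * l"
    by (simp add: S_def M_def card_image)
  have "int (size T) = W" if T: "T \<subseteq># S" "T \<noteq> {#}" "zero_sum ?G T" for T
  proof -
    obtain N where N: "N \<subseteq># M" "T = image_mset g N"
      using T(1) unfolding S_def by (rule subseteq_image_msetE)
    define a where "a i = int (count N (Inl i))" for i
    define b where "b j = int (count N (Inr j))" for j
    have le: "count N x \<le> count M x" for x using N(1) by (simp add: mset_subset_eq_count)
    have setN: "set_mset N \<subseteq> Inl ` {..<r} \<union> Inr ` {..<l}"
    proof
      fix x assume "x \<in># N"
      then have "count M x > 0" using le[of x] by (metis count_greater_zero_iff less_le_trans)
      then show "x \<in> Inl ` {..<r} \<union> Inr ` {..<l}"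
        by (cases x) (auto simp: M_def count_mset_set' split: if_splits)
    qed
    have sumN: "(\<Sum>x\<in>#N. k x) = (\<Sum>i<r. a i * k (Inl i)) + (\<Sum>j<l. b j * k (Inr j))"
      for k :: "_ \<Rightarrow> int"
      by (subst sum_mset_eq_sum_count[OF _ setN], simp, subst sum.union_disjoint)
         (auto simp: sum.reindex a_def b_def)
    \<comment> \<open>With at most \<open>n - 1\<close> copies, a multiplicity is determined by its
      residue modulo \<open>n\<close>.\<close>
    have a: "0 \<le> a i" "a i < int n" if "i < r" for i
      using le[of "Inl i"] that assms(1) by (auto simp: a_def M_def count_mset_set' split: if_splits)
    have b: "0 \<le> b j \<and> b j \<le> int (p - 1)" if "j < l" for j
      using le[of "Inr j"] that by (auto simp: b_def M_def count_mset_set' split: if_splits)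
    have a_eq: "a i = (- (\<Sum>j<l. b j * F' j i)) mod int n" if i: "i < r" for i
    proof -
      have "int n dvd (\<Sum>x\<in>#T. x i)"
        using T(3) over i unfolding N(2) by (rule zero_sum_cyclic_powerD)
      also have "(\<Sum>x\<in>#T. x i) = (\<Sum>x\<in>#N. g x i)" by (simp add: N(2) image_mset.compositionality comp_def)
      also have "\<dots> = (\<Sum>k<r. if k = i then a k else 0) + (\<Sum>j<l. b j * (F' j i mod int n))"
        unfolding sumN using i by (intro arg_cong2[of _ _ _ _ "(+)"] sum.cong) (auto simp: g_def)
      also have "\<dots> = a i + (\<Sum>j<l. b j * (F' j i mod int n))" using i by simp
      finally have "(a i + (\<Sum>j<l. b j * (F' j i mod int n))) mod int n = 0" by simp
      moreover have "(\<Sum>j<l. b j * (F' j i mod int n)) mod int n = (\<Sum>j<l. b j * F' j i) mod int n"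
        by (subst (1 2) mod_sum_eq[symmetric]) (simp add: mod_mult_right_eq)
      ultimately have "(a i + (\<Sum>j<l. b j * F' j i)) mod int n = 0"
        by (metis mod_add_right_eq)
      then have "a i mod int n = (- (\<Sum>j<l. b j * F' j i)) mod int n"
        by (simp add: mod_eq_dvd_iff mod_eq_0_iff_dvd)
      then show ?thesis using a[OF i] by simp
    qed
    have "\<exists>j<l. b j \<noteq> 0"
    proof (rule ccontr)
      assume "\<not> ?thesis"
      then have b0: "b j = 0" if "j < l" for j using that by auto
      then have "a i = 0" if "i < r" for i using a_eq[OF that] by simp
      with b0 have "count N x = 0" if "x \<in># N" for x
        using setN that by (auto simp: a_def b_def)
      then have "N = {#}" by (metis count_eq_zero_iff multiset_nonemptyE)
      with T(2) N(2) show False by simp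
    qed
    \<comment> \<open>The subtraction \<open>p - 1\<close> is truncated; a nonzero
      \<open>b j\<close> excludes \<open>p = 0\<close>, and the bound becomes
      \<open>b j < p\<close>.\<close>
    moreover from this have "p \<ge> 1" using b by (metis diff_0_eq_0 le_antisym of_nat_0 not_less_eq_eq One_nat_def diff_is_0_eq' nle_le)
    ultimately have W: "(\<Sum>j<l. b j) + (\<Sum>i\<in>I. (- (\<Sum>j<l. b j * F j i)) mod int n) = W"
      using b by (intro weight) (auto simp: of_nat_diff)
    have "int (size T) = (\<Sum>x\<in>#N. 1)" by (simp add: N(2))
    also have "\<dots> = (\<Sum>i<r. a i) + (\<Sum>j<l. b j)" by (subst sumN) simp
    also have "(\<Sum>i<r. a i) = (\<Sum>i<card I. a i)"
      using assms(3) by (intro sum.mono_neutral_right) (auto simp: a_eq F'_def)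
    also have "\<dots> = (\<Sum>i<card I. (- (\<Sum>j<l. b j * F j (h i))) mod int n)"
      using assms(3) by (intro sum.cong) (auto simp: a_eq F'_def)
    also have "\<dots> = (\<Sum>i\<in>I. (- (\<Sum>j<l. b j * F j i)) mod int n)"
      by (rule sum.reindex_bij_betw[OF h])
    finally show ?thesis using W by simp
  qed
  with over size show ?thesis unfolding S_def by blast
qed

subsection \<open>Points off a hyperplane\<close>

definition vecs :: "nat \<Rightarrow> nat \<Rightarrow> nat list set" where
  "vecs p l = {v. set v \<subseteq> {..<p} \<and> length v = l}"

text \<open>The vectors over \<open>{0..<p}\<close> whose first nonzero entry is \<open>1\<close>: normalised representatives of
  the points of projective space over \<open>F\<^sub>p\<close>.\<close>

fun points :: "nat \<Rightarrow> nat \<Rightarrow> nat list set" where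
  "points p 0 = {}"
| "points p (Suc l) = (#) 0 ` points p l \<union> (#) 1 ` vecs p l"

definition dot :: "nat list \<Rightarrow> (nat \<Rightarrow> int) \<Rightarrow> int" where
  "dot v b = (\<Sum>j<length v. int (v ! j) * b j)"

definition unit_vec :: "nat \<Rightarrow> nat \<Rightarrow> nat list" where
  "unit_vec l j = (replicate l 0)[j := 1]"

lemma dot_Cons: "dot (x # v) b = int x * b 0 + dot v (\<lambda>j. b (Suc j))"
  unfolding dot_def by (simp add: sum.lessThan_Suc_shift del: sum.lessThan_Suc)

lemma finite_vecs [simp]: "finite (vecs p l)"
  unfolding vecs_def by (rule finite_lists_length_eq) simp

lemma card_vecs [simp]: "card (vecs p l) = p ^ l"
  unfolding vecs_def by (subst card_lists_length_eq) simp_all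

lemma vecs_Suc: "vecs p (Suc l) = (\<Union>x<p. (#) x ` vecs p l)"
  unfolding vecs_def by (auto simp: length_Suc_conv image_iff)

lemma finite_points [simp]: "finite (points p l)"
  by (induction l) auto

lemma card_Cons_image [simp]: "card ((#) x ` V) = card V"
  by (rule card_image) (auto simp: inj_on_def)

lemma card_points: "p \<ge> 1 \<Longrightarrow> (p - 1) * card (points p l) = p ^ l - 1"
proof (induction l)
  case (Suc l)
  have "card (points p (Suc l)) = card (points p l) + p ^ l"
    by (simp, subst card_Un_disjoint) auto
  with Suc have "(p - 1) * card (points p (Suc l)) = p ^ l - 1 + (p - 1) * p ^ l"
    by (simp add: distrib_left)
  with Suc.prems show ?case
    by (simp add: diff_mult_distrib)
qed simp

lemma unit_Suc_0: "unit_vec (Suc l) 0 = 1 # replicate l 0"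
  by (simp add: unit_vec_def)

lemma unit_Suc_Suc: "unit_vec (Suc l) (Suc j) = 0 # unit_vec l j"
  by (simp add: unit_vec_def)

lemma length_unit [simp]: "length (unit_vec l j) = l"
  by (simp add: unit_vec_def)

lemma unit_nth: "i < l \<Longrightarrow> unit_vec l j ! i = (if i = j then 1 else 0)"
  by (simp add: unit_vec_def nth_list_update)

lemma unit_in_vecs: "p \<ge> 2 \<Longrightarrow> unit_vec l j \<in> vecs p l"
  using set_update_subset_insert[of "replicate l (0::nat)" j 1]
  by (force simp: unit_vec_def vecs_def)

lemma unit_in_points: "p \<ge> 2 \<Longrightarrow> j < l \<Longrightarrow> unit_vec l j \<in> points p l"
proof (induction l arbitrary: j)
  case (Suc l)
  then show ?case
    by (cases j) (auto simp: unit_Suc_0 unit_Suc_Suc vecs_def)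
qed simp

lemma inj_on_unit: "inj_on (unit_vec l) {..<l}"
  by (rule inj_onI) (metis unit_nth lessThan_iff zero_neq_one)

lemma dot_unit:
  assumes "j < l"
  shows "dot (unit_vec l j) b = b j"
proof -
  have "dot (unit_vec l j) b = (\<Sum>i<l. if i = j then b i else 0)"
    unfolding dot_def by (intro sum.cong) (auto simp: unit_nth)
  with assms show ?thesis by simp
qed

lemma length_points: "v \<in> points p l \<Longrightarrow> length v = l"
  by (induction l arbitrary: v) (auto simp: vecs_def)

lemma dvd_dot: "\<forall>j<length v. q dvd b j \<Longrightarrow> q dvd dot v b"
  unfolding dot_def by (auto intro!: dvd_sum)

text \<open>Stripping the first entry \<open>x\<close> turns \<open>c\<close> into
  \<open>x * b 0 + c\<close>, so the induction needs affine hyperplanes. The factor \<open>p\<close>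
  avoids the exponent \<open>l - 1\<close>.\<close>

lemma card_hyperplane:
  assumes "prime p" "\<exists>j<l. \<not> int p dvd b j"
  shows "p * card {v \<in> vecs p l. int p dvd dot v b + c} = p ^ l"
  using assms(2)
proof (induction l arbitrary: b c)
  case (Suc l)
  let ?b = "\<lambda>j. b (Suc j)"
  have "{v \<in> vecs p (Suc l). int p dvd dot v b + c}
      = (\<Union>x<p. (#) x ` {v \<in> vecs p l. int p dvd dot v ?b + (int x * b 0 + c)})"
    by (auto simp: vecs_Suc dot_Cons algebra_simps)
  then have card: "card {v \<in> vecs p (Suc l). int p dvd dot v b + c}
      = (\<Sum>x<p. card {v \<in> vecs p l. int p dvd dot v ?b + (int x * b 0 + c)})"
    by (simp, subst card_UN_disjoint) auto
  show ?case
  proof (cases "\<exists>j<l. \<not> int p dvd ?b j")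
    case True
    have "p * card {v \<in> vecs p (Suc l). int p dvd dot v b + c} = (\<Sum>x<p. p ^ l)"
      unfolding card sum_distrib_left by (intro sum.cong refl Suc.IH[OF True])
    then show ?thesis by simp
  next
    \<comment> \<open>Only the first entry matters now: exactly one \<open>x\<close> satisfies the
      congruence, and it admits all \<open>p ^ l\<close> tails.\<close>
    case False
    then have b0: "\<not> int p dvd b 0"
      using Suc.prems by (metis less_Suc_eq_0_disj)
    have cop: "coprime (b 0) (int p)"
      using b0 assms(1) prime_imp_coprime[of "int p" "b 0"] by (simp add: coprime_commute)
    have p: "p > 0" using assms(1) prime_gt_0_nat by blast
    have dv: "int p dvd dot v ?b + d \<longleftrightarrow> int p dvd d" if "v \<in> vecs p l" for v d
      by (rule dvd_add_right_iff, rule dvd_dot) (use that False in \<open>auto simp: vecs_def\<close>)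
    obtain x0 where x0: "x0 < p" "int p dvd int x0 * b 0 + c"
    proof -
      \<comment> \<open>By Bezout \<open>y\<close> inverts \<open>b 0\<close> modulo
        \<open>p\<close>, so the solution is the residue of \<open>- c * y\<close>.\<close>
      obtain y z where "y * b 0 + z * int p = 1"
        using cop bezout_int[of "b 0" "int p"] by (auto simp: coprime_iff_gcd_eq_1)
      then have "b 0 * y - 1 = int p * (- z)" by (simp add: algebra_simps)
      then have d: "int p dvd (b 0 * y - 1) * (- c)" by simp
      define z where "z = (- c * y) mod int p"
      have z: "0 \<le> z" "z < int p" using p by (auto simp: z_def)
      have "int p dvd (- c * y) - z" unfolding z_def by (rule dvd_minus_mod)
      then have "int p dvd (b 0 * y - 1) * (- c) - ((- c * y) - z) * b 0"
        by (intro dvd_diff[OF d] dvd_mult2)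
      then have "int p dvd int (nat z) * b 0 + c" using z by (simp add: algebra_simps)
      with z show ?thesis using that[of "nat z"] by auto
    qed
    have uniq: "x = x0" if "x < p" "int p dvd int x * b 0 + c" for x
    proof -
      have "int p dvd (int x * b 0 + c) - (int x0 * b 0 + c)"
        using that x0 by (intro dvd_diff)
      then have "int p dvd b 0 * (int x - int x0)" by (simp add: algebra_simps)
      then have "int p dvd int x - int x0"
        using cop by (metis coprime_commute coprime_dvd_mult_right_iff)
      then have "int x mod int p = int x0 mod int p" by (simp add: mod_eq_dvd_iff)
      then show ?thesis using that x0 by simp
    qed
    have "card {v \<in> vecs p l. int p dvd dot v ?b + (int x * b 0 + c)}
        = (if x = x0 then p ^ l else 0)" if "x < p" for x
    proof -
      have "{v \<in> vecs p l. int p dvd dot v ?b + (int x * b 0 + c)}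
         = {v \<in> vecs p l. int p dvd int x * b 0 + c}"
        by (intro Collect_cong conj_cong refl dv)
      moreover have "int p dvd int x * b 0 + c \<longleftrightarrow> x = x0"
        using uniq[OF that] x0(2) by metis
      ultimately show ?thesis by simp
    qed
    then have "(\<Sum>x<p. card {v \<in> vecs p l. int p dvd dot v ?b + (int x * b 0 + c)}) = p ^ l"
      using x0(1) by simp
    then show ?thesis unfolding card by simp
  qed
qed simp

text \<open>Points starting with 0 are handled by induction; those starting with 1 form an affine
  space, cut by the hyperplane with constant \<open>b 0\<close>. If the tail of \<open>b\<close> is
  nonzero modulo \<open>p\<close>, the counts are \<open>p ^ (l - 1)\<close> and
  \<open>p ^ l - p ^ (l - 1)\<close>; otherwise they are 0 and \<open>p ^ l\<close>.\<close>

lemma card_points_off_hyperplane: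
  assumes "prime p" "\<exists>j<l. \<not> int p dvd b j"
  shows "card {v \<in> points p l. \<not> int p dvd dot v b} = p ^ (l - 1)"
  using assms(2)
proof (induction l arbitrary: b)
  case (Suc l)
  let ?b = "\<lambda>j. b (Suc j)"
  let ?H = "{v \<in> vecs p l. int p dvd dot v ?b + b 0}"
  have "{v \<in> points p (Suc l). \<not> int p dvd dot v b}
     = (#) 0 ` {v \<in> points p l. \<not> int p dvd dot v ?b} \<union> (#) 1 ` (vecs p l - ?H)"
    by (auto simp: dot_Cons add.commute)
  then have "card {v \<in> points p (Suc l). \<not> int p dvd dot v b}
     = card {v \<in> points p l. \<not> int p dvd dot v ?b} + card (vecs p l - ?H)"
    by (simp, subst card_Un_disjoint) auto
  also have "card (vecs p l - ?H) = p ^ l - card ?H"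
    by (subst card_Diff_subset) auto
  finally have card: "card {v \<in> points p (Suc l). \<not> int p dvd dot v b}
     = card {v \<in> points p l. \<not> int p dvd dot v ?b} + (p ^ l - card ?H)" .
  show ?case
  proof (cases "\<exists>j<l. \<not> int p dvd ?b j")
    case True
    then obtain k where l: "l = Suc k" by (cases l) auto
    have "p * card ?H = p * p ^ k"
      using card_hyperplane[OF assms(1) True] l by simp
    then have "card ?H = p ^ k" using assms(1) prime_gt_0_nat by simp
    then show ?thesis
      using card Suc.IH[OF True] l prime_gt_0_nat[OF assms(1)] by simp
  next
    case False
    then have b0: "\<not> int p dvd b 0"
      using Suc.prems by (metis less_Suc_eq_0_disj)
    have dv: "int p dvd dot v ?b" if "length v = l" for v
      by (rule dvd_dot) (use that False in auto)
    have H: "?H = {}" using dv b0 by (auto simp: vecs_def dvd_add_right_iff)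
    have P: "{v \<in> points p l. \<not> int p dvd dot v ?b} = {}"
      using dv length_points by blast
    show ?thesis unfolding card H P by simp
  qed
qed simp

subsection \<open>Constant weight matrices\<close>

text \<open>The unit points are split off because the copies of row \<open>j\<close> themselves
  contribute to the length, which saves one coordinate for each \<open>j\<close>.\<close>

lemma sum_points_minus_units:
  assumes "prime p" "\<exists>j<l. \<not> int p dvd b j"
  shows "(\<Sum>j<l. of_bool (\<not> int p dvd b j))
    + (\<Sum>v\<in>points p l - unit_vec l ` {..<l}. of_bool (\<not> int p dvd dot v b)) = int p ^ (l - 1)"
proof -
  let ?f = "\<lambda>v. of_bool (\<not> int p dvd dot v b) :: int"
  have U: "unit_vec l ` {..<l} \<subseteq> points p l"
    using assms(1) by (auto intro: unit_in_points prime_ge_2_nat)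
  have "(\<Sum>j<l. of_bool (\<not> int p dvd b j)) = (\<Sum>v\<in>unit_vec l ` {..<l}. ?f v)"
    by (simp add: sum.reindex[OF inj_on_unit] dot_unit)
  then have "(\<Sum>j<l. of_bool (\<not> int p dvd b j)) + (\<Sum>v\<in>points p l - unit_vec l ` {..<l}. ?f v)
      = (\<Sum>v\<in>points p l. ?f v)"
    using sum.subset_diff[OF U, of ?f] by simp
  also have "\<dots> = int (card {v \<in> points p l. \<not> int p dvd dot v b})"
    by (simp add: Int_def)
  finally show ?thesis
    by (simp add: card_points_off_hyperplane[OF assms])
qed

lemma card_points_minus_units:
  assumes "p \<ge> 2"
  shows "card (points p l - unit_vec l ` {..<l}) = card (points p l) - l"
    and "l \<le> card (points p l)"
proof -
  have U: "unit_vec l ` {..<l} \<subseteq> points p l"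
    using assms by (auto intro: unit_in_points)
  then have "card (unit_vec l ` {..<l}) \<le> card (points p l)" by (intro card_mono) auto
  then show "l \<le> card (points p l)" by (simp add: card_image[OF inj_on_unit])
  show "card (points p l - unit_vec l ` {..<l}) = card (points p l) - l"
    using U by (subst card_Diff_subset) (auto simp: card_image[OF inj_on_unit])
qed

lemma dot_eq_sum: "length v = l \<Longrightarrow> (\<Sum>j<l. b j * (c * int (v ! j))) = c * dot v b"
  by (simp add: dot_def sum_distrib_left algebra_simps)

lemma mod_add_uminus_mod:
  fixes x n :: int
  assumes "n > 0"
  shows "x mod n + (- x) mod n = n * of_bool (\<not> n dvd x)"
  using assms by (auto simp: zmod_zminus1_eq_if mod_eq_0_iff_dvd)

text \<open>\<open>Inl i\<close> is the unit coordinate, whose residue the copies of row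
  \<open>i\<close> complete to \<open>n\<close>; the Boolean in \<open>Inr (v, s)\<close> is the
  sign of the functional. The index set has \<open>l + 2 * (card (points p l) - l)\<close> elements,
  which is \<open>theta l p\<close>.\<close>

lemma weight_odd_prime:
  assumes "prime p" "n = m * p" "n \<ge> 2"
    and b: "\<And>j. j < l \<Longrightarrow> 0 \<le> b j \<and> b j < int p" and ne: "\<exists>j<l. b j \<noteq> 0"
  defines "J \<equiv> points p l - unit_vec l ` {..<l}"
  defines "F \<equiv> \<lambda>j. case_sum (\<lambda>i. of_bool (i = j))
     (\<lambda>(v, s). (if s then int m else - int m) * int (v ! j))"
  shows "(\<Sum>j<l. b j) + (\<Sum>i\<in>{..<l} <+> J \<times> (UNIV :: bool set). (- (\<Sum>j<l. b j * F j i)) mod int n)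
    = int n * int p ^ (l - 1)"
proof -
  have m: "m > 0" using assms(2,3) by (cases m) auto
  have n: "int n > 0" using assms(3) by simp
  have "p \<le> n" using m assms(2) by simp
  \<comment> \<open>As \<open>b j < p \<le> n\<close>, divisibility by \<open>n\<close> and by
    \<open>p\<close> both mean \<open>b j = 0\<close> and may be interchanged.\<close>
  then have small: "int n dvd b j \<longleftrightarrow> b j = 0" "int p dvd b j \<longleftrightarrow> b j = 0" "b j mod int n = b j"
    if "j < l" for j
    using b[OF that] by (auto dest!: zdvd_imp_le)
  have fin: "finite J" by (simp add: J_def)
  have unit_part: "(- (\<Sum>j<l. b j * F j (Inl i))) mod int n = (- b i) mod int n" if "i < l" for i
  proof -
    have "(\<Sum>j<l. b j * F j (Inl i)) = (\<Sum>j<l. if j = i then b j else 0)"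
      by (intro sum.cong) (auto simp: F_def)
    with that show ?thesis by simp
  qed
  have sum_F: "(\<Sum>j<l. b j * F j (Inr (v, s))) = (if s then int m else - int m) * dot v b"
    if "v \<in> J" for v s
    using dot_eq_sum[of v l b "if s then int m else - int m"] that length_points
    by (auto simp: F_def J_def)
  have pair_part: "(\<Sum>s\<in>UNIV. (- (\<Sum>j<l. b j * F j (Inr (v, s)))) mod int n)
      = int n * of_bool (\<not> int p dvd dot v b)" if "v \<in> J" for v
    using mod_add_uminus_mod[OF n, of "int m * dot v b"] m assms(2)
    by (simp add: sum_F[OF that] UNIV_bool)
  have "(\<Sum>i\<in>{..<l} <+> J \<times> (UNIV :: bool set). (- (\<Sum>j<l. b j * F j i)) mod int n)
     = (\<Sum>i<l. (- b i) mod int n) + (\<Sum>v\<in>J. int n * of_bool (\<not> int p dvd dot v b))"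
    using fin by (simp add: sum.Plus sum.cartesian_product' unit_part pair_part)
  also have "(\<Sum>j<l. b j) + \<dots>
      = (\<Sum>j<l. b j + (- b j) mod int n) + (\<Sum>v\<in>J. int n * of_bool (\<not> int p dvd dot v b))"
    by (simp add: sum.distrib)
  also have "(\<Sum>j<l. b j + (- b j) mod int n) = (\<Sum>j<l. int n * of_bool (\<not> int p dvd b j))"
  proof (intro sum.cong refl)
    fix j assume "j \<in> {..<l}"
    then show "b j + (- b j) mod int n = int n * of_bool (\<not> int p dvd b j)"
      using mod_add_uminus_mod[OF n, of "b j"] small[of j] by (simp only: lessThan_iff)
  qed
  also have "\<dots> + (\<Sum>v\<in>J. int n * of_bool (\<not> int p dvd dot v b)) = int n * int p ^ (l - 1)"
    unfolding J_def sum_distrib_left[symmetric] distrib_left[symmetric]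
    using assms(1) ne small by (subst sum_points_minus_units) auto
  finally show ?thesis .
qed

text \<open>For \<open>p = 2\<close> the coordinates \<open>m * v\<close> alone give the length
  \<open>m * 2 ^ (l - 1) - (m - 1) * (\<Sum>j<l. b j)\<close>. To add the missing \<open>m - 1\<close> for every \<open>j\<close> with
  \<open>b j = 1\<close>, the entry \<open>m\<close> of row \<open>j\<close> is replaced by \<open>1 = m - (m - 1)\<close> at one point of weight two
  involving \<open>j\<close>, its partner: \<open>e\<^sub>0 + e\<^sub>j\<close>, or \<open>e\<^sub>0 + e\<^sub>1\<close> if \<open>j = 0\<close> (\<open>j - 1\<close> is truncated).\<close>

definition partner :: "nat \<Rightarrow> nat \<Rightarrow> nat list" where
  "partner l j = 1 # unit_vec (l - 1) (j - 1)"

text \<open>A partner has two nonzero entries, at 0 and at \<open>Suc (j - 1)\<close>, so it is no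
  unit vector.\<close>

lemma partner_in_points:
  assumes "l \<ge> 2" "j < l"
  shows "partner l j \<in> points 2 l - unit_vec l ` {..<l}"
proof -
  obtain k where l: "l = Suc k" using assms(1) by (cases l) auto
  have "partner l j \<in> points 2 l"
    using unit_in_vecs[of 2 k "j - 1"] by (simp add: partner_def l)
  moreover have "partner l j \<noteq> unit_vec l i" if "i < l" for i
  proof
    assume eq: "partner l j = unit_vec l i"
    have "j - 1 < k" using assms l by auto
    then have "partner l j ! 0 = 1" "partner l j ! Suc (j - 1) = 1" "Suc (j - 1) < l"
      by (simp_all add: partner_def l unit_nth)
    then have "0 = i" "Suc (j - 1) = i"
      using eq l by (metis unit_nth zero_less_Suc zero_neq_one, metis unit_nth zero_neq_one)
    then show False by simp
  qed
  ultimately show ?thesis by auto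
qed

lemma partner_nth: "l \<ge> 2 \<Longrightarrow> j < l \<Longrightarrow> partner l j ! j = 1"
  by (cases j) (auto simp: partner_def unit_nth)

text \<open>With truncated subtraction, this says that rows 0 and 1 are the only distinct rows that
  can share a partner.\<close>

lemma partner_eqD:
  assumes "l \<ge> 2" "i < l" "j < l" "partner l i = partner l j"
  shows "i - 1 = j - 1"
proof -
  have "i - 1 < l - 1" using assms by auto
  then show ?thesis
    using assms(4) unit_nth[of "i - 1" "l - 1"] by (auto simp: partner_def split: if_splits)
      (metis unit_nth zero_neq_one)
qed

lemma dot_partner:
  assumes "l \<ge> 2" "j < l"
  shows "dot (partner l j) b = b 0 + b (if j = 0 then 1 else j)"
  using assms by (auto simp: partner_def dot_Cons dot_unit)

lemma weight_two:
  assumes "n = m * 2" "m > 0" "l \<ge> 2"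
    and b: "\<And>j. j < l \<Longrightarrow> 0 \<le> b j \<and> b j < int 2" and ne: "\<exists>j<l. b j \<noteq> 0"
  defines "J \<equiv> points 2 l - unit_vec l ` {..<l}"
  defines "F \<equiv> \<lambda>j v. if v = partner l j then 1 else int m * int (v ! j)"
  shows "(\<Sum>j<l. b j) + (\<Sum>v\<in>J. (- (\<Sum>j<l. b j * F j v)) mod int n) = int m * 2 ^ (l - 1)"
proof -
  \<comment> \<open>\<open>(m - 1) * K v\<close> is the correction at \<open>v\<close>; it must not make the coordinate wrap around mod \<open>n\<close>.\<close>
  define K where "K v = (\<Sum>j | j < l \<and> partner l j = v. b j)" for v
  have fin: "finite J" by (simp add: J_def)
  have b01: "b j = 0 \<or> b j = 1" if "j < l" for j using b[OF that] by auto
  have small: "of_bool (odd (b j)) = b j" if "j < l" for j using b01[OF that] by auto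
  have coord: "(- (\<Sum>j<l. b j * F j v)) mod int n = int m * of_bool (odd (dot v b)) + (int m - 1) * K v"
    if v: "v \<in> J" for v
  proof -
    \<comment> \<open>Each row with partner \<open>v\<close> has its entry \<open>m\<close> lowered
      by \<open>m - 1\<close>; \<open>partner_nth\<close> ensures that the entry was
      \<open>m\<close>.\<close>
    have "(\<Sum>j<l. b j * F j v)
        = (\<Sum>j<l. b j * (int m * int (v ! j)) - (int m - 1) * (if partner l j = v then b j else 0))"
      using partner_nth[OF assms(3)] by (intro sum.cong) (auto simp: F_def algebra_simps)
    also have "\<dots> = int m * dot v b - (int m - 1) * K v"
      using dot_eq_sum[of v l b "int m"] length_points v
      by (auto simp: J_def K_def sum_subtractf sum_distrib_left[symmetric] sum.If_cases Int_def)
    finally have "- (\<Sum>j<l. b j * F j v) = - (int m * dot v b) + (int m - 1) * K v" by simp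
    also have "\<dots> mod int n = (int m * of_bool (odd (dot v b)) + (int m - 1) * K v) mod int n"
    proof -
      have "- (int m * dot v b) - int m * of_bool (odd (dot v b))
          = int m * (- dot v b - of_bool (odd (dot v b)))" by (simp add: algebra_simps)
      also have "int n dvd \<dots>" unfolding assms(1) of_nat_mult
        by (intro mult_dvd_mono) auto
      finally show ?thesis by (simp add: mod_eq_dvd_iff)
    qed
    also have "\<dots> = int m * of_bool (odd (dot v b)) + (int m - 1) * K v"
    \<comment> \<open>\<open>K v = 2\<close> occurs only at the common partner of rows 0 and 1,
      where \<open>dot v b\<close> is then even, leaving \<open>2 * (m - 1) < n\<close>. Otherwise
      the value is at most \<open>m + (m - 1) < n\<close>.\<close>
    proof -
      have "0 \<le> K v" using b by (auto simp: K_def intro: sum_nonneg)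
      moreover have "K v \<le> 1 \<or> (K v = 2 \<and> even (dot v b))"
      proof (cases "v = partner l 0")
        case True
        have "{j. j < l \<and> partner l j = v} = {0, 1}"
        proof (intro equalityI subsetI)
          fix j assume "j \<in> {j. j < l \<and> partner l j = v}"
          then have "j - 1 = 0 - 1" using True assms(3) by (intro partner_eqD) auto
          then show "j \<in> {0, 1}" by auto
        qed (use True assms(3) in \<open>auto simp: partner_def\<close>)
        then have "K v = b 0 + b 1" by (simp add: K_def)
        moreover have "dot v b = b 0 + b 1" using True dot_partner[of l 0] assms(3) by simp
        ultimately show ?thesis using b01[of 0] b01[of 1] assms(3) by auto
      next
        case False
        show ?thesis
        proof (cases "\<exists>i<l. partner l i = v")
          case True
          then obtain i where i: "i < l" "partner l i = v" by blast
          have "j = i" if "j < l" "partner l j = v" for j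
          proof -
            have "j - 1 = i - 1" using that i assms(3) by (intro partner_eqD) auto
            moreover have "i \<noteq> 0" "j \<noteq> 0" using i(2) that(2) False by metis+
            ultimately show ?thesis by simp
          qed
          then have "{j. j < l \<and> partner l j = v} = {i}" using i by blast
          then have "K v = b i" unfolding K_def by simp
          then show ?thesis using b01[OF i(1)] by auto
        next
          case False
          then have empty: "{j. j < l \<and> partner l j = v} = {}" by auto
          have "K v = 0" unfolding K_def empty by simp
          then show ?thesis by simp
        qed
      qed
      ultimately have "K v = 0 \<or> K v = 1 \<or> K v = 2 \<and> even (dot v b)" by auto
      then show ?thesis using assms(1,2) by (intro mod_pos_pos_trivial) auto
    qed
    finally show ?thesis .
  qed
  \<comment> \<open>Every row has exactly one partner, and it lies in \<open>J\<close>, so each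
    \<open>b j\<close> is counted once.\<close>
  have "(\<Sum>v\<in>J. K v) = (\<Sum>j<l. b j)"
  proof -
    have "(\<Sum>v\<in>J. sum b {j \<in> {..<l}. partner l j = v}) = (\<Sum>j<l. b j)"
      using fin partner_in_points[OF assms(3)] by (intro sum.group) (auto simp: J_def)
    then show ?thesis by (simp add: K_def)
  qed
  then have "(\<Sum>v\<in>J. (- (\<Sum>j<l. b j * F j v)) mod int n)
      = int m * (\<Sum>v\<in>J. of_bool (odd (dot v b))) + (int m - 1) * (\<Sum>j<l. b j)"
    by (simp add: coord sum.distrib flip: sum_distrib_left)
  moreover have "(\<Sum>j<l. b j) + (\<Sum>v\<in>J. of_bool (odd (dot v b))) = 2 ^ (l - 1)"
  proof -
    have "\<exists>j<l. odd (b j)" using ne b01 by fastforce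
    then show ?thesis
      using sum_points_minus_units[of 2 l b] small by (simp add: J_def)
  qed
  ultimately show ?thesis by (simp add: algebra_simps flip: distrib_left)
qed

section \<open>From integer weights to the values of \<open>omega\<close> and
  \<open>theta\<close>\<close>

lemma omega_eq_odd:
  assumes "p > 2" "l \<ge> 1"
  shows "omega l n p = of_nat (n * p ^ (l - 1))"
proof -
  have "int l - 1 = int (l - 1)" using assms(2) by simp
  then show ?thesis using assms(1) by (simp add: omega_def power_int_of_nat del: of_nat_diff)
qed

lemma omega_eq_two:
  assumes "l \<ge> 2"
  shows "omega l (m * 2) 2 = of_nat (m * 2 ^ (l - 1))"
proof -
  obtain k where k: "l = k + 2" using assms by (metis add.commute le_Suc_ex)
  then have "int l - 2 = int k" by simp
  then show ?thesis by (simp add: omega_def k)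
qed

theorem theorem3p1:
  fixes G :: "(nat \<Rightarrow> int) monoid" and n r p l :: nat
  assumes "r \<ge> 1" and "n \<ge> 2"
    and "G = cyclic_power n r"
    and "prime p" and "p dvd n"
    and "l \<ge> 1"
    and "int r \<ge> theta l p" and "theta l p \<ge> 1"
  shows "\<exists>S. sequence_over G S
           \<and> size S = (n - 1) * r + (p - 1) * l
           \<and> size S = D_star G + (p - 1) * l - 1
           \<and> (\<forall>T. T \<subseteq># S \<and> T \<noteq> {#} \<and> zero_sum G T \<longrightarrow> of_nat (size T) = omega l n p)"
proof -
  let ?J = "points p l - unit_vec l ` {..<l}"
  have p2: "p \<ge> 2" using assms(4) by (rule prime_ge_2_nat)
  obtain m where m: "n = m * p" using assms(5) by (metis dvd_div_mult_self)
  have m0: "m > 0" using m assms(2) by (cases m) auto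
  have cardP: "(p - 1) * card (points p l) = p ^ l - 1" using p2 by (intro card_points) simp
  note cardJ = card_points_minus_units[OF p2, of l]
  have "\<exists>W. of_nat W = omega l n p \<and> (\<exists>S. sequence_over G S \<and> size S = (n - 1) * r + (p - 1) * l \<and>
      (\<forall>T. T \<subseteq># S \<and> T \<noteq> {#} \<and> zero_sum G T \<longrightarrow> int (size T) = int W))"
  proof (cases "p > 2")
    case True
    let ?I = "{..<l} <+> ?J \<times> (UNIV :: bool set)"
    have cardI: "card ?I = 2 * card (points p l) - l"
      using cardJ by (simp add: card_Plus card_cartesian_product)
    \<comment> \<open>The point count makes the division in \<open>theta\<close> exact and
      identifies \<open>theta l p\<close> with the size of the index set.\<close>
    have "(int p - 1) * int (card (points p l)) = int p ^ l - 1"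
      using arg_cong[OF cardP, of int] p2 by (simp add: of_nat_diff)
    then have "theta l p = ((int p - 1) * (2 * int (card (points p l)))) div (int p - 1) - int l"
      using True by (simp add: theta_def mult.left_commute)
    also have "\<dots> = 2 * int (card (points p l)) - int l" using True by simp
    finally have "card ?I \<le> r" using assms(7) cardI by simp
    then have "\<exists>S. sequence_over G S \<and> size S = (n - 1) * r + (p - 1) * l \<and>
      (\<forall>T. T \<subseteq># S \<and> T \<noteq> {#} \<and> zero_sum G T \<longrightarrow> int (size T) = int n * int p ^ (l - 1))"
      unfolding assms(3)
      by (intro sequence_from_matrix[OF assms(2) _ _ weight_odd_prime[OF assms(4) m assms(2)]]) auto
    then show ?thesis
      using omega_eq_odd[OF True assms(6)] by (intro exI[of _ "n * p ^ (l - 1)"]) simp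
  next
    case False
    then have p: "p = 2" using p2 by simp
    \<comment> \<open>\<open>theta 1 2 = 0\<close> is excluded by assumption; partners need two
      distinct positions.\<close>
    have l2: "l \<ge> 2"
    proof (rule ccontr)
      assume "\<not> ?thesis"
      then have "l = 1" using assms(6) by simp
      then show False using assms(8) p by (simp add: theta_def)
    qed
    have "int (card (points p l)) = 2 ^ l - 1" using cardP p by (simp add: of_nat_diff)
    then have "card ?J \<le> r" using assms(7) cardJ p by (simp add: theta_def of_nat_diff)
    then have "\<exists>S. sequence_over G S \<and> size S = (n - 1) * r + (p - 1) * l \<and>
      (\<forall>T. T \<subseteq># S \<and> T \<noteq> {#} \<and> zero_sum G T \<longrightarrow> int (size T) = int m * 2 ^ (l - 1))"
      unfolding assms(3) p
      by (intro sequence_from_matrix[OF assms(2) _ _ weight_two[OF m[unfolded p] m0 l2]]) auto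
    then show ?thesis
      using omega_eq_two[OF l2, of m] by (intro exI[of _ "m * 2 ^ (l - 1)"]) (simp add: m p)
  qed
  then obtain W S where W: "of_nat W = omega l n p"
    and S: "sequence_over G S" "size S = (n - 1) * r + (p - 1) * l"
      "\<forall>T. T \<subseteq># S \<and> T \<noteq> {#} \<and> zero_sum G T \<longrightarrow> int (size T) = int W"
    by blast
  have "size S = D_star G + (p - 1) * l - 1"
    using D_star_cyclic_power[OF assms(1,2)] S(2) by (simp add: assms(3) mult.commute)
  then show ?thesis using S W by (intro exI[of _ S]) auto
qed

end
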